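(* Let $L\to M$ be a complex line bundle over a Poisson manifold $(M,\pi)$, $\mathcal E=\Gamma^\infty(L)$, and let $\star=\sum_rC_r\lambda^r$ and $\star'=\sum_rC_r'\lambda^r$ be star products on $(M,\pi)$ with $C_1=C_1'$. Let $(\mathcal E[[\lambda]],\bullet,\bullet')$ be a bimodule quantization of $L$ corresponding to $\star,\star'$, with $s\bullet f=sf+\sum_{r\ge1}R_r(s,f)\lambda^r$ and $f\bullet's=fs+\sum_{r\ge1}R'_r(f,s)\lambda^r$ for $s\in\mathcal E$, $f\in C^\infty(M)$. Then the map $R:\mathcal E\times C^\infty(M)\to\mathcal E$, $R(s,f):=R_1(s,f)-R_1'(f,s)$, is a contravariant connection on $L$.
   Context: $C^\infty(M)$ denotes complex-valued smooth functions and $\{f,g\}=\pi(df,dg)$. A star product on $(M,\pi)$ is an associative $\mathbb C[[\lambda]]$-bilinear product on $C^\infty(M)[[\lambda]]$, $f\star g=\sum_{r\ge0}C_r(f,g)\lambda^r$, with $C_0(f,g)=fg$, all $C_r$ bidifferential, and $C_1(f,g)-C_1(g,f)=\{f,g\}$. A bimodule quantization of $L$ corresponding to $\star,\star'$ consists of a right $(C^\infty(M)[[\lambda]],\star)$-module structure $\bullet$ and a left $(C^\infty(M)[[\lambda]],\star')$-module structure $\bullet'$ on $\mathcal E[[\lambda]]$, of the displayed form with $R_r,R_r'$ bidifferential, such that $(f\bullet's)\bullet g=f\bullet'(s\bullet g)$ and such that $\bullet'$ induces an isomorphism of $(C^\infty(M)[[\lambda]],\star')$ onto the algebra of right-module endomorphisms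 of $(\mathcal E[[\lambda]],\bullet)$. A contravariant connection on $L$ is a $\mathbb C$-bilinear map $D':\Gamma^\infty(L)\times C^\infty(M)\to\Gamma^\infty(L)$ satisfying $D'(s,fg)=D'(s,f)g+D'(s,g)f$ and $D'(sf,g)=D'(s,g)f+s\{f,g\}$ for all $s\in\Gamma^\infty(L)$, $f,g\in C^\infty(M)$. *)

theory Defs
  imports "HOL-Analysis.Analysis" "HOL-Library.Function_Algebras"
    "HOL-Computational_Algebra.Formal_Power_Series"
begin

section \<open>Smooth functions on open subsets of Euclidean space\<close>

text \<open>
  Points of n-dimensional Euclidean space are functions \<open>y :: nat \<Rightarrow> real\<close> vanishing at all
  indices \<open>i \<ge> n\<close>, as in \<open>Euclidean_space n\<close>; in particular \<open>n = 0\<close> is allowed.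
\<close>

definition partial :: "nat \<Rightarrow> ((nat \<Rightarrow> real) \<Rightarrow> 'b::real_normed_vector) \<Rightarrow> (nat \<Rightarrow> real) \<Rightarrow> 'b" where
  "partial i F y = vector_derivative (\<lambda>t. F (y(i := t))) (at (y i))"

text \<open>
  Iterated partial derivatives are indexed by words (lists) of coordinate indices:
  \<open>partials [i, j] F = partial i (partial j F)\<close>.
\<close>

definition partials :: "nat list \<Rightarrow> ((nat \<Rightarrow> real) \<Rightarrow> 'b::real_normed_vector) \<Rightarrow> (nat \<Rightarrow> real) \<Rightarrow> 'b" where
  "partials I F = foldr partial I F"

text \<open>\<open>F\<close> is of class C-infinity on the open subset \<open>V\<close> of \<open>Euclidean_space n\<close>:
  all iterated partial derivatives exist and are continuous on \<open>V\<close>.\<close>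

definition smooth_on :: "nat \<Rightarrow> (nat \<Rightarrow> real) set \<Rightarrow> ((nat \<Rightarrow> real) \<Rightarrow> 'b::real_normed_vector) \<Rightarrow> bool" where
  "smooth_on n V F \<longleftrightarrow>
     (\<forall>I. set I \<subseteq> {..<n} \<longrightarrow>
        continuous_on V (partials I F) \<and>
        (\<forall>i<n. \<forall>y\<in>V. (\<lambda>t. partials I F (y(i := t))) differentiable (at (y i))))"

section \<open>Smooth manifolds\<close>

text \<open>
  A chart is a pair of its domain and its coordinate map. The underlying topological space
  is the whole type \<open>'m\<close>, which is Hausdorff and second countable by its sort. The atlas need not
  be maximal.
\<close>

type_synonym 'm chart = "'m set \<times> ('m \<Rightarrow> nat \<Rightarrow> real)"

record 'm smooth_space =
  mdim :: nat
  atlas :: "'m chart set"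

definition in_chart :: "'m chart \<Rightarrow> ('m \<Rightarrow> 'b) \<Rightarrow> (nat \<Rightarrow> real) \<Rightarrow> 'b" where
  "in_chart c f = f \<circ> inv_into (fst c) (snd c)"

definition smooth_in ::
  "'m smooth_space \<Rightarrow> 'm chart \<Rightarrow> 'm set \<Rightarrow> ('m \<Rightarrow> 'b::real_normed_vector) \<Rightarrow> bool" where
  "smooth_in M c W f \<longleftrightarrow> smooth_on (mdim M) (snd c ` W) (in_chart c f)"

definition chart_deriv :: "'m chart \<Rightarrow> nat list \<Rightarrow> ('m \<Rightarrow> 'b::real_normed_vector) \<Rightarrow> 'm \<Rightarrow> 'b" where
  "chart_deriv c I f x = partials I (in_chart c f) (snd c x)"

definition smooth_manifold ::
  "'m::{t2_space, second_countable_topology} smooth_space \<Rightarrow> bool" where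
  "smooth_manifold M \<longleftrightarrow>
     (\<Union>c\<in>atlas M. fst c) = UNIV \<and>
     (\<forall>c\<in>atlas M. open (fst c) \<and> openin (Euclidean_space (mdim M)) (snd c ` fst c) \<and>
        homeomorphism (fst c) (snd c ` fst c) (snd c) (inv_into (fst c) (snd c))) \<and>
     (\<forall>c\<in>atlas M. \<forall>d\<in>atlas M. \<forall>i<mdim M.
        smooth_in M c (fst c \<inter> fst d) (\<lambda>x. snd d x i))"

definition C_inf :: "'m smooth_space \<Rightarrow> ('m \<Rightarrow> complex) set" where
  "C_inf M = {f. \<forall>c\<in>atlas M. smooth_in M c (fst c) f}"

section \<open>Poisson structures\<close>

text \<open>
  A bivector field is given by its components \<open>\<pi> c x i j\<close> in every chart \<open>c\<close> of the atlas: real,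
  smooth, antisymmetric, and transforming as a contravariant 2-tensor under changes of charts.
\<close>

type_synonym 'm bivector = "'m chart \<Rightarrow> 'm \<Rightarrow> nat \<Rightarrow> nat \<Rightarrow> real"

definition bivector_field :: "'m smooth_space \<Rightarrow> 'm bivector \<Rightarrow> bool" where
  "bivector_field M \<pi> \<longleftrightarrow>
     (\<forall>c\<in>atlas M. \<forall>i<mdim M. \<forall>j<mdim M.
        smooth_in M c (fst c) (\<lambda>x. \<pi> c x i j) \<and>
        (\<forall>x\<in>fst c. \<pi> c x j i = - \<pi> c x i j)) \<and>
     (\<forall>c\<in>atlas M. \<forall>d\<in>atlas M. \<forall>x\<in>fst c \<inter> fst d. \<forall>i<mdim M. \<forall>j<mdim M.
        \<pi> d x i j =
          (\<Sum>k<mdim M. \<Sum>l<mdim M.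
             \<pi> c x k l * chart_deriv c [k] (\<lambda>y. snd d y i) x * chart_deriv c [l] (\<lambda>y. snd d y j) x))"

text \<open>
  The function \<open>\<pi>(df, dg)\<close>, extended complex bilinearly to complex-valued functions. By the
  transformation law of \<open>\<pi>\<close> its value at a point does not depend on the chosen chart.
\<close>

definition bracket ::
  "'m smooth_space \<Rightarrow> 'm bivector \<Rightarrow> ('m \<Rightarrow> complex) \<Rightarrow> ('m \<Rightarrow> complex) \<Rightarrow> 'm \<Rightarrow> complex" where
  "bracket M \<pi> f g x =
     (let c = (SOME c. c \<in> atlas M \<and> x \<in> fst c) in
        \<Sum>i<mdim M. \<Sum>j<mdim M.
          complex_of_real (\<pi> c x i j) * chart_deriv c [i] f x * chart_deriv c [j] g x)"

definition poisson_structure :: "'m smooth_space \<Rightarrow> 'm bivector \<Rightarrow> bool" where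
  "poisson_structure M \<pi> \<longleftrightarrow>
     bivector_field M \<pi> \<and>
     (\<forall>f\<in>C_inf M. \<forall>g\<in>C_inf M. \<forall>h\<in>C_inf M.
        bracket M \<pi> f (bracket M \<pi> g h) + bracket M \<pi> g (bracket M \<pi> h f)
          + bracket M \<pi> h (bracket M \<pi> f g) = 0)"

section \<open>Complex line bundles and their sections\<close>

text \<open>
  The fibres are one-dimensional subspaces of a complex vector space on the type \<open>'v\<close>. This
  ambient space carries no topology and plays no geometric role; it only supplies the fibrewise
  operations. Every family of fibres occurs in this way, e.g. inside the direct sum of all fibres.
  The smooth structure of the bundle is given by local trivializations: pairs of an open set \<open>V\<close>
  and a family of linear isomorphisms \<open>h x\<close> from the fibres over \<open>x \<in> V\<close> to the complex numbers,
  with smooth nowhere vanishing transition functions.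
\<close>

record ('m, 'v) vbundle =
  fibre :: "'m \<Rightarrow> 'v set"
  smul :: "complex \<Rightarrow> 'v \<Rightarrow> 'v"
  trivs :: "('m set \<times> ('m \<Rightarrow> 'v \<Rightarrow> complex)) set"

definition complex_line_bundle ::
  "'m::topological_space smooth_space \<Rightarrow> ('m, 'v::ab_group_add) vbundle \<Rightarrow> bool" where
  "complex_line_bundle M L \<longleftrightarrow>
     vector_space (smul L) \<and>
     (\<forall>x. module.subspace (smul L) (fibre L x) \<and> vector_space.dim (smul L) (fibre L x) = 1) \<and>
     (\<Union>t\<in>trivs L. fst t) = UNIV \<and>
     (\<forall>t\<in>trivs L. open (fst t) \<and>
        (\<forall>x\<in>fst t. bij_betw (snd t x) (fibre L x) UNIV \<and>
           (\<forall>u\<in>fibre L x. \<forall>v\<in>fibre L x. snd t x (u + v) = snd t x u + snd t x v) \<and>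
           (\<forall>a. \<forall>u\<in>fibre L x. snd t x (smul L a u) = a * snd t x u))) \<and>
     (\<forall>t\<in>trivs L. \<forall>t'\<in>trivs L. \<exists>\<tau>.
        (\<forall>x\<in>fst t \<inter> fst t'. \<tau> x \<noteq> 0 \<and> (\<forall>v\<in>fibre L x. snd t' x v = \<tau> x * snd t x v)) \<and>
        (\<forall>c\<in>atlas M. smooth_in M c (fst c \<inter> fst t \<inter> fst t') \<tau>))"

definition sections :: "'m smooth_space \<Rightarrow> ('m, 'v) vbundle \<Rightarrow> ('m \<Rightarrow> 'v) set" where
  "sections M L =
     {s. (\<forall>x. s x \<in> fibre L x) \<and>
         (\<forall>c\<in>atlas M. \<forall>t\<in>trivs L. smooth_in M c (fst c \<inter> fst t) (\<lambda>x. snd t x (s x)))}"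

definition trivial_bundle :: "('m, complex) vbundle" where
  "trivial_bundle = \<lparr>fibre = (\<lambda>_. UNIV), smul = (*), trivs = {(UNIV, \<lambda>_ v. v)}\<rparr>"

lemma sections_trivial_bundle: "sections M trivial_bundle = C_inf M"
  by (simp add: sections_def C_inf_def trivial_bundle_def)

definition fun_smul :: "('m, 'v) vbundle \<Rightarrow> ('m \<Rightarrow> complex) \<Rightarrow> ('m \<Rightarrow> 'v) \<Rightarrow> 'm \<Rightarrow> 'v" where
  "fun_smul L f s = (\<lambda>x. smul L (f x) (s x))"

section \<open>Bilinear maps and bidifferential operators\<close>

definition bilinear_on ::
  "('k \<Rightarrow> 'a \<Rightarrow> 'a) \<Rightarrow> 'a set \<Rightarrow> ('k \<Rightarrow> 'b \<Rightarrow> 'b) \<Rightarrow> 'b set \<Rightarrow> ('k \<Rightarrow> 'c \<Rightarrow> 'c) \<Rightarrow> 'c set \<Rightarrow>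
   ('a::plus \<Rightarrow> 'b::plus \<Rightarrow> 'c::plus) \<Rightarrow> bool" where
  "bilinear_on sA A sB B sC C m \<longleftrightarrow>
     (\<forall>a\<in>A. \<forall>b\<in>B. m a b \<in> C) \<and>
     (\<forall>a\<in>A. \<forall>a'\<in>A. \<forall>b\<in>B. m (a + a') b = m a b + m a' b) \<and>
     (\<forall>a\<in>A. \<forall>b\<in>B. \<forall>b'\<in>B. m a (b + b') = m a b + m a b') \<and>
     (\<forall>k. \<forall>a\<in>A. \<forall>b\<in>B. m (sA k a) b = sC k (m a b) \<and> m a (sB k b) = sC k (m a b))"

definition cscale :: "('m, 'v) vbundle \<Rightarrow> complex \<Rightarrow> ('m \<Rightarrow> 'v) \<Rightarrow> 'm \<Rightarrow> 'v" where
  "cscale L a s = (\<lambda>x. smul L a (s x))"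

definition words :: "nat \<Rightarrow> nat \<Rightarrow> nat list set" where
  "words n K = {I. set I \<subseteq> {..<n} \<and> length I \<le> K}"

text \<open>
  Bidifferential operators of finite order from sections of \<open>L1\<close> and \<open>L2\<close> to sections of \<open>L3\<close>:
  complex bilinear maps which, in all charts and local trivializations, are sums of terms
  \<open>a \<cdot> (\<partial>\<^sub>I s1) \<cdot> (\<partial>\<^sub>J s2)\<close> with smooth coefficients \<open>a\<close> and words \<open>I\<close>, \<open>J\<close> of length at
  most \<open>K\<close>. For functions one takes the trivial bundle.
\<close>

definition bidifferential ::
  "'m smooth_space \<Rightarrow> ('m, 'u::plus) vbundle \<Rightarrow> ('m, 'v::plus) vbundle \<Rightarrow> ('m, 'w::plus) vbundle \<Rightarrow>
   (('m \<Rightarrow> 'u) \<Rightarrow> ('m \<Rightarrow> 'v) \<Rightarrow> 'm \<Rightarrow> 'w) \<Rightarrow> bool" where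
  "bidifferential M L1 L2 L3 B \<longleftrightarrow>
     bilinear_on (cscale L1) (sections M L1) (cscale L2) (sections M L2)
       (cscale L3) (sections M L3) B \<and>
     (\<exists>K. \<forall>c\<in>atlas M. \<forall>t1\<in>trivs L1. \<forall>t2\<in>trivs L2. \<forall>t3\<in>trivs L3. \<exists>a.
        let W = fst c \<inter> fst t1 \<inter> fst t2 \<inter> fst t3 in
          (\<forall>I\<in>words (mdim M) K. \<forall>J\<in>words (mdim M) K. smooth_in M c W (a I J)) \<and>
          (\<forall>s1\<in>sections M L1. \<forall>s2\<in>sections M L2. \<forall>x\<in>W.
             snd t3 x (B s1 s2 x) =
               (\<Sum>I\<in>words (mdim M) K. \<Sum>J\<in>words (mdim M) K.
                  a I J x * chart_deriv c I (\<lambda>y. snd t1 y (s1 y)) x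
                          * chart_deriv c J (\<lambda>y. snd t2 y (s2 y)) x)))"

section \<open>Star products\<close>

definition formal :: "'a set \<Rightarrow> 'a fps set" where
  "formal A = {F. \<forall>k. fps_nth F k \<in> A}"

definition formal_scale ::
  "('m, 'v::comm_monoid_add) vbundle \<Rightarrow> complex fps \<Rightarrow> ('m \<Rightarrow> 'v) fps \<Rightarrow> ('m \<Rightarrow> 'v) fps" where
  "formal_scale L a F = Abs_fps (\<lambda>k. \<Sum>i\<le>k. cscale L (fps_nth a i) (fps_nth F (k - i)))"

abbreviation formal_C_inf :: "'m smooth_space \<Rightarrow> ('m \<Rightarrow> complex) fps set" where
  "formal_C_inf M \<equiv> formal (C_inf M)"

abbreviation formal_sections ::
  "'m smooth_space \<Rightarrow> ('m, 'v) vbundle \<Rightarrow> ('m \<Rightarrow> 'v) fps set" where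
  "formal_sections M L \<equiv> formal (sections M L)"

text \<open>
  The formal parameter is \<open>fps_X\<close>. The product \<open>star\<close> lives on formal power series; \<open>C r\<close> is its
  \<open>r\<close>-th coefficient on functions, which determines \<open>star\<close> by bilinearity over formal power series.
\<close>

definition star_product ::
  "'m smooth_space \<Rightarrow> 'm bivector \<Rightarrow>
   (('m \<Rightarrow> complex) fps \<Rightarrow> ('m \<Rightarrow> complex) fps \<Rightarrow> ('m \<Rightarrow> complex) fps) \<Rightarrow>
   (nat \<Rightarrow> ('m \<Rightarrow> complex) \<Rightarrow> ('m \<Rightarrow> complex) \<Rightarrow> 'm \<Rightarrow> complex) \<Rightarrow> bool" where
  "star_product M \<pi> star C \<longleftrightarrow>
     bilinear_on (formal_scale trivial_bundle) (formal_C_inf M)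
       (formal_scale trivial_bundle) (formal_C_inf M)
       (formal_scale trivial_bundle) (formal_C_inf M) star \<and>
     (\<forall>F\<in>formal_C_inf M. \<forall>G\<in>formal_C_inf M. \<forall>H\<in>formal_C_inf M.
        star (star F G) H = star F (star G H)) \<and>
     (\<forall>f\<in>C_inf M. \<forall>g\<in>C_inf M.
        star (fps_const f) (fps_const g) = Abs_fps (\<lambda>r. C r f g)) \<and>
     (\<forall>f\<in>C_inf M. \<forall>g\<in>C_inf M. C 0 f g = f * g) \<and>
     (\<forall>r. bidifferential M trivial_bundle trivial_bundle trivial_bundle (C r)) \<and>
     (\<forall>f\<in>C_inf M. \<forall>g\<in>C_inf M. C 1 f g - C 1 g f = bracket M \<pi> f g)"

section \<open>Bimodule quantizations\<close>

text \<open>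
  Endomorphisms of the right module of formal sections, as maps that are \<open>undefined\<close> outside
  of it, so that they are determined by their values on formal sections.
\<close>

definition right_endos ::
  "'m smooth_space \<Rightarrow> ('m, 'v::comm_monoid_add) vbundle \<Rightarrow>
   (('m \<Rightarrow> 'v) fps \<Rightarrow> ('m \<Rightarrow> complex) fps \<Rightarrow> ('m \<Rightarrow> 'v) fps) \<Rightarrow>
   (('m \<Rightarrow> 'v) fps \<Rightarrow> ('m \<Rightarrow> 'v) fps) set" where
  "right_endos M L bul =
     {T \<in> formal_sections M L \<rightarrow>\<^sub>E formal_sections M L.
        (\<forall>S\<in>formal_sections M L. \<forall>S'\<in>formal_sections M L. T (S + S') = T S + T S') \<and>
        (\<forall>a. \<forall>S\<in>formal_sections M L. T (formal_scale L a S) = formal_scale L a (T S)) \<and>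
        (\<forall>S\<in>formal_sections M L. \<forall>F\<in>formal_C_inf M. T (bul S F) = bul (T S) F)}"

text \<open>
  \<open>bul\<close> is the right action for \<open>star\<close>, with coefficients \<open>R r\<close>, and \<open>bul'\<close> the left action for
  \<open>star'\<close>, with coefficients \<open>R' r\<close> (\<open>r \<ge> 1\<close>); \<open>R 0\<close> and \<open>R' 0\<close> are irrelevant. In the last clause,
  that the bijection is a homomorphism of algebras is the statement that \<open>bul'\<close> is a left action
  which is bilinear over formal power series.
\<close>

definition bimodule_quantization ::
  "'m smooth_space \<Rightarrow> ('m, 'v::comm_monoid_add) vbundle \<Rightarrow>
   (('m \<Rightarrow> complex) fps \<Rightarrow> ('m \<Rightarrow> complex) fps \<Rightarrow> ('m \<Rightarrow> complex) fps) \<Rightarrow>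
   (('m \<Rightarrow> complex) fps \<Rightarrow> ('m \<Rightarrow> complex) fps \<Rightarrow> ('m \<Rightarrow> complex) fps) \<Rightarrow>
   (('m \<Rightarrow> 'v) fps \<Rightarrow> ('m \<Rightarrow> complex) fps \<Rightarrow> ('m \<Rightarrow> 'v) fps) \<Rightarrow>
   (nat \<Rightarrow> ('m \<Rightarrow> 'v) \<Rightarrow> ('m \<Rightarrow> complex) \<Rightarrow> 'm \<Rightarrow> 'v) \<Rightarrow>
   (('m \<Rightarrow> complex) fps \<Rightarrow> ('m \<Rightarrow> 'v) fps \<Rightarrow> ('m \<Rightarrow> 'v) fps) \<Rightarrow>
   (nat \<Rightarrow> ('m \<Rightarrow> complex) \<Rightarrow> ('m \<Rightarrow> 'v) \<Rightarrow> 'm \<Rightarrow> 'v) \<Rightarrow> bool" where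
  "bimodule_quantization M L star star' bul R bul' R' \<longleftrightarrow>
     bilinear_on (formal_scale L) (formal_sections M L)
       (formal_scale trivial_bundle) (formal_C_inf M)
       (formal_scale L) (formal_sections M L) bul \<and>
     (\<forall>S\<in>formal_sections M L. \<forall>F\<in>formal_C_inf M. \<forall>G\<in>formal_C_inf M.
        bul (bul S F) G = bul S (star F G)) \<and>
     bilinear_on (formal_scale trivial_bundle) (formal_C_inf M)
       (formal_scale L) (formal_sections M L)
       (formal_scale L) (formal_sections M L) bul' \<and>
     (\<forall>S\<in>formal_sections M L. \<forall>F\<in>formal_C_inf M. \<forall>G\<in>formal_C_inf M.
        bul' F (bul' G S) = bul' (star' F G) S) \<and>
     (\<forall>s\<in>sections M L. \<forall>f\<in>C_inf M.
        bul (fps_const s) (fps_const f) = Abs_fps (\<lambda>r. if r = 0 then fun_smul L f s else R r s f)) \<and>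
     (\<forall>s\<in>sections M L. \<forall>f\<in>C_inf M.
        bul' (fps_const f) (fps_const s) = Abs_fps (\<lambda>r. if r = 0 then fun_smul L f s else R' r f s)) \<and>
     (\<forall>r\<ge>1. bidifferential M L trivial_bundle L (R r)) \<and>
     (\<forall>r\<ge>1. bidifferential M trivial_bundle L L (R' r)) \<and>
     (\<forall>S\<in>formal_sections M L. \<forall>F\<in>formal_C_inf M. \<forall>G\<in>formal_C_inf M.
        bul (bul' F S) G = bul' F (bul S G)) \<and>
     bij_betw (\<lambda>F. restrict (bul' F) (formal_sections M L)) (formal_C_inf M) (right_endos M L bul)"

section \<open>Contravariant connections\<close>

definition contravariant_connection ::
  "'m smooth_space \<Rightarrow> 'm bivector \<Rightarrow> ('m, 'v::plus) vbundle \<Rightarrow>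
   (('m \<Rightarrow> 'v) \<Rightarrow> ('m \<Rightarrow> complex) \<Rightarrow> 'm \<Rightarrow> 'v) \<Rightarrow> bool" where
  "contravariant_connection M \<pi> L D \<longleftrightarrow>
     bilinear_on (cscale L) (sections M L) (cscale trivial_bundle) (C_inf M)
       (cscale L) (sections M L) D \<and>
     (\<forall>s\<in>sections M L. \<forall>f\<in>C_inf M. \<forall>g\<in>C_inf M.
        D s (f * g) = fun_smul L g (D s f) + fun_smul L f (D s g)) \<and>
     (\<forall>s\<in>sections M L. \<forall>f\<in>C_inf M. \<forall>g\<in>C_inf M.
        D (fun_smul L f s) g = fun_smul L f (D s g) + fun_smul L (bracket M \<pi> f g) s)"

end

theory Submission
  imports Defs
begin

text \<open>
  Write \<open>s \<bullet> f = s f + \<lambda> R\<^sub>1(s,f) + \<dots>\<close> and \<open>f \<bullet>' s = f s + \<lambda> R'\<^sub>1(f,s) + \<dots>\<close>. Two formal expressions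
  that agree have the same coefficient of \<open>\<lambda>\<close>. For the right action, the left action and their
  compatibility this gives, with \<open>C\<^sub>1 = C'\<^sub>1\<close>,
  \<^item> \<open>R\<^sub>1(f s, g) + g R\<^sub>1(s,f) = R\<^sub>1(s, f g) + C\<^sub>1(f,g) s\<close>,
  \<^item> \<open>R'\<^sub>1(f g, s) + C\<^sub>1(f,g) s = R'\<^sub>1(f, g s) + f R'\<^sub>1(g,s)\<close>,
  \<^item> \<open>R\<^sub>1(f s, g) + g R'\<^sub>1(f,s) = R'\<^sub>1(f, g s) + f R\<^sub>1(s,g)\<close>.

  Subtracting the second identity from the first cancels \<open>C\<^sub>1\<close>, and the third turns what is left
  into the Leibniz rule of \<open>D = R\<^sub>1 - R'\<^sub>1\<close> in its function argument. For the rule in the section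
  argument, the third identity expresses \<open>R\<^sub>1(f s, g)\<close> by \<open>R'\<^sub>1(f, g s)\<close>, so that
  \<open>D(f s, g)\<close> contains \<open>R'\<^sub>1(f, g s) - R'\<^sub>1(g, f s)\<close>; since \<open>f g = g f\<close>, the second identity
  evaluates this difference, and its \<open>C\<^sub>1\<close> terms combine to the Poisson bracket \<open>C\<^sub>1(f,g) - C\<^sub>1(g,f)\<close>.

  Two points need care. First, the actions are given on all formal series, while \<open>R\<^sub>1\<close> and \<open>R'\<^sub>1\<close>
  only describe them on constant ones. Writing \<open>F = F\<^sub>0 + \<lambda> F'\<close> twice and using linearity over
  formal power series expresses the first two coefficients of a product by products of constants
  (\<open>first_order_identity\<close>). Second, \<open>D\<close> must map into smooth sections, so these have to be closed under subtraction (\<open>sections_diff\<close>).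
\<close>

section \<open>Differences of smooth functions and sections\<close>

lemma eventually_fun_upd_in_openin:
  assumes V: "openin (Euclidean_space n) V" and y: "y \<in> V" and i: "i < n"
  shows "\<forall>\<^sub>F t in nhds (y i). y(i := t) \<in> V"
proof -
  obtain U where U: "open U" "V = U \<inter> {x. \<forall>k\<ge>n. x k = 0}"
    using V by (auto simp: Euclidean_space_def openin_subtopology euclidean_product_topology)
  have "continuous_on UNIV (\<lambda>t. y(i := t))"
  proof (rule continuous_on_coordinatewise_then_product)
    show "continuous_on UNIV (\<lambda>t. (y(i := t)) k)" for k
      by (cases "k = i") auto
  qed
  then have "open ((\<lambda>t. y(i := t)) -` U)"
    using U(1) by (auto simp: continuous_on_open_vimage[OF open_UNIV])
  moreover have "y i \<in> (\<lambda>t. y(i := t)) -` U"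
    using y U(2) by simp
  ultimately have "\<forall>\<^sub>F t in nhds (y i). t \<in> (\<lambda>t. y(i := t)) -` U"
    by (rule eventually_nhds_in_open)
  then show ?thesis
    by (rule eventually_mono) (use y i U(2) in auto)
qed

text \<open>
  Only the values on \<open>V\<close> are constrained, while a partial derivative at \<open>y\<close> depends on the function
  near \<open>y\<close> on a coordinate line. As \<open>V\<close> is relatively open it contains a piece of that line, and the
  formula on all of \<open>V\<close> is therefore strong enough to be differentiated again.
\<close>
lemma partials_diff:
  assumes V: "openin (Euclidean_space n) V"
    and F: "smooth_on n V F" and G: "smooth_on n V G"
    and H: "\<forall>y\<in>V. H y = F y - G y"
    and "set I \<subseteq> {..<n}"
  shows "y \<in> V \<Longrightarrow> partials I H y = partials I F y - partials I G y"
  using \<open>set I \<subseteq> {..<n}\<close>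
proof (induction I arbitrary: y)
  case Nil
  then show ?case by (simp add: partials_def H)
next
  case (Cons i I)
  then have i: "i < n" and I: "set I \<subseteq> {..<n}" by auto
  let ?d = "\<lambda>K. (\<lambda>t. partials I K (y(i := t)))"
  have ev: "\<forall>\<^sub>F t in nhds (y i). ?d H t = ?d F t - ?d G t"
    using eventually_fun_upd_in_openin[OF V Cons.prems(1) i]
    by (rule eventually_mono) (rule Cons.IH[OF _ I])
  have "?d F differentiable at (y i)" "?d G differentiable at (y i)"
    using F G I i Cons.prems(1) by (auto simp: smooth_on_def)
  then have "vector_derivative (\<lambda>t. ?d F t - ?d G t) (at (y i)) =
      vector_derivative (?d F) (at (y i)) - vector_derivative (?d G) (at (y i))"
    by (rule vector_derivative_diff_at)
  moreover have "vector_derivative (?d H) (at (y i)) =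
      vector_derivative (\<lambda>t. ?d F t - ?d G t) (at (y i))"
    by (rule vector_derivative_cong_eq) (use ev in auto)
  ultimately show ?case by (simp add: partials_def partial_def)
qed

text \<open>
  The equation for \<open>H\<close> is local, for use with sections: in a trivialization a difference of sections
  becomes a difference of functions only over the domain of that trivialization.
\<close>
lemma smooth_on_diff:
  assumes V: "openin (Euclidean_space n) V"
    and F: "smooth_on n V F" and G: "smooth_on n V G"
    and H: "\<forall>y\<in>V. H y = F y - G y"
  shows "smooth_on n V H"
  unfolding smooth_on_def
proof (intro allI impI conjI ballI)
  fix I assume I: "set I \<subseteq> {..<n}"
  note eq = partials_diff[OF V F G H I]
  have "continuous_on V (\<lambda>y. partials I F y - partials I G y)"
    using F G I by (auto simp: smooth_on_def intro: continuous_on_diff)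
  then show "continuous_on V (partials I H)"
    using eq by (simp cong: continuous_on_cong)
  fix i y assume i: "i < n" and y: "y \<in> V"
  have ev: "\<forall>\<^sub>F t in nhds (y i).
      partials I F (y(i := t)) - partials I G (y(i := t)) = partials I H (y(i := t))"
    using eventually_fun_upd_in_openin[OF V y i] by (rule eventually_mono) (simp add: eq)
  have "(\<lambda>t. partials I F (y(i := t)) - partials I G (y(i := t))) differentiable at (y i)"
    using F G I i y by (auto simp: smooth_on_def intro: differentiable_diff)
  then obtain D where
    "((\<lambda>t. partials I F (y(i := t)) - partials I G (y(i := t))) has_vector_derivative D) (at (y i))"
    by (auto simp: vector_derivative_works)
  then have "((\<lambda>t. partials I H (y(i := t))) has_vector_derivative D) (at (y i))"
    by (subst has_vector_derivative_cong_ev) (use ev eq[OF y] in \<open>auto elim: eventually_mono\<close>)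
  then show "(\<lambda>t. partials I H (y(i := t))) differentiable at (y i)"
    by (rule differentiableI_vector)
qed

text \<open>
  The domain of a chart is usually larger than its overlap with the domain \<open>U\<close> of a trivialization,
  and smoothness of sections is tested on that overlap.
\<close>
lemma openin_chart_image:
  assumes M: "smooth_manifold M" and c: "c \<in> atlas M" and U: "open U"
  shows "openin (Euclidean_space (mdim M)) (snd c ` (fst c \<inter> U))"
proof -
  have hom: "homeomorphism (fst c) (snd c ` fst c) (snd c) (inv_into (fst c) (snd c))"
    and op: "openin (Euclidean_space (mdim M)) (snd c ` fst c)"
    using M c by (auto simp: smooth_manifold_def)
  have "openin (top_of_set (snd c ` fst c)) (snd c ` (fst c \<inter> U))"
    by (rule homeomorphism_imp_open_map[OF hom]) (use U in auto)
  moreover have "top_of_set (snd c ` fst c)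
      = subtopology (Euclidean_space (mdim M)) (snd c ` fst c)"
    using openin_subset[OF op]
    by (auto simp: Euclidean_space_def euclidean_product_topology subtopology_subtopology
        topspace_subtopology Int_absorb1 Int_absorb2)
  ultimately show ?thesis
    using op openin_trans_full by metis
qed

lemma smooth_in_diff:
  assumes "smooth_manifold M" "c \<in> atlas M" "open U"
    and "smooth_in M c (fst c \<inter> U) f" "smooth_in M c (fst c \<inter> U) g"
    and h: "\<And>x. x \<in> U \<Longrightarrow> h x = f x - g x"
  shows "smooth_in M c (fst c \<inter> U) h"
proof -
  have "inj_on (snd c) (fst c)"
    using assms(1,2) unfolding smooth_manifold_def homeomorphism_def
    by (intro inj_on_inverseI[where g = "inv_into (fst c) (snd c)"]) blast
  then show ?thesis
    unfolding smooth_in_def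
    by (intro smooth_on_diff[OF openin_chart_image[OF assms(1-3)] assms(4,5)[unfolded smooth_in_def]])
      (auto simp: in_chart_def h)
qed

lemma C_inf_diff:
  assumes "smooth_manifold M" "f \<in> C_inf M" "g \<in> C_inf M"
  shows "f - g \<in> C_inf M"
  using assms smooth_in_diff[OF assms(1) _ open_UNIV, of _ f g "f - g"]
  by (auto simp: C_inf_def)

text \<open>
  Over its domain a trivialization is additive on the fibres, so it turns the difference of two
  sections into the difference of their coordinate functions.
\<close>
lemma sections_diff:
  assumes M: "smooth_manifold M" and L: "complex_line_bundle M L"
    and s: "s \<in> sections M L" and s': "s' \<in> sections M L"
  shows "s - s' \<in> sections M L"
proof -
  interpret vector_space "smul L" using L by (simp add: complex_line_bundle_def)
  have sub: "subspace (fibre L x)" for x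
    using L by (simp add: complex_line_bundle_def)
  have mem: "s x \<in> fibre L x" "s' x \<in> fibre L x" "(s - s') x \<in> fibre L x" for x
    using s s' sub by (auto simp: sections_def subspace_diff)
  have "smooth_in M c (fst c \<inter> fst t) (\<lambda>x. snd t x ((s - s') x))"
    if c: "c \<in> atlas M" and t: "t \<in> trivs L" for c t
  proof (rule smooth_in_diff[OF M c])
    have triv: "open (fst t) \<and> (\<forall>x\<in>fst t. bij_betw (snd t x) (fibre L x) UNIV \<and>
        (\<forall>u\<in>fibre L x. \<forall>v\<in>fibre L x. snd t x (u + v) = snd t x u + snd t x v) \<and>
        (\<forall>a. \<forall>u\<in>fibre L x. snd t x (smul L a u) = a * snd t x u))"
      using L t unfolding complex_line_bundle_def by (elim conjE) (erule bspec)
    show "open (fst t)" using triv by (rule conjunct1)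
    show "smooth_in M c (fst c \<inter> fst t) (\<lambda>x. snd t x (s x))"
      "smooth_in M c (fst c \<inter> fst t) (\<lambda>x. snd t x (s' x))"
      using s s' c t by (simp_all add: sections_def)
    show "snd t x ((s - s') x) = snd t x (s x) - snd t x (s' x)" if "x \<in> fst t" for x
    proof -
      have "snd t x ((s - s') x + s' x) = snd t x ((s - s') x) + snd t x (s' x)"
        using triv that mem by blast
      then show ?thesis by simp
    qed
  qed
  then show ?thesis using mem(3) by (simp add: sections_def)
qed

section \<open>First order coefficients of formal bilinear maps\<close>

lemma vector_space_trivial_bundle: "vector_space (smul trivial_bundle)"
  by unfold_locales (auto simp: trivial_bundle_def algebra_simps)

lemma formal_scale_fps_X_nth:
  assumes "vector_space (smul L)"
  shows "fps_nth (formal_scale L fps_X F) k = (if k = 0 then 0 else fps_nth F (k - 1))"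
proof -
  interpret vector_space "smul L" by fact
  have "fps_nth (formal_scale L fps_X F) k = (\<Sum>i\<le>k. if i = 1 then fps_nth F (k - 1) else 0)"
    unfolding formal_scale_def fps_nth_Abs_fps
    by (intro sum.cong) (auto simp: cscale_def fun_eq_iff)
  then show ?thesis by (auto simp: sum.delta)
qed

lemma formal_decompose:
  assumes "vector_space (smul L)"
  shows "fps_const (fps_nth F 0) + formal_scale L fps_X (fps_shift 1 F) = F"
  by (rule fps_ext) (simp add: formal_scale_fps_X_nth[OF assms])

lemma fps_const_in_formal: "0 \<in> A \<Longrightarrow> a \<in> A \<Longrightarrow> fps_const a \<in> formal A"
  by (auto simp: formal_def)

lemma fps_shift_in_formal: "F \<in> formal A \<Longrightarrow> fps_shift n F \<in> formal A"
  by (auto simp: formal_def)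

lemma formal_bilinear_expand_left:
  assumes L1: "vector_space (smul L1)" and A: "0 \<in> A"
    and m: "bilinear_on (formal_scale L1) (formal A) sB B (formal_scale L3) C m"
    and F: "F \<in> formal A" and G: "G \<in> B"
  shows "m F G = m (fps_const (fps_nth F 0)) G + formal_scale L3 fps_X (m (fps_shift 1 F) G)"
proof -
  have c: "fps_const (fps_nth F 0) \<in> formal A"
    using A F by (intro fps_const_in_formal) (auto simp: formal_def)
  have "formal_scale L1 fps_X (fps_shift 1 F) \<in> formal A"
    using A F by (auto simp: formal_def formal_scale_fps_X_nth[OF L1])
  then have "m (fps_const (fps_nth F 0) + formal_scale L1 fps_X (fps_shift 1 F)) G
      = m (fps_const (fps_nth F 0)) G + m (formal_scale L1 fps_X (fps_shift 1 F)) G"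
    using m c G unfolding bilinear_on_def by blast
  also have "m (formal_scale L1 fps_X (fps_shift 1 F)) G
      = formal_scale L3 fps_X (m (fps_shift 1 F) G)"
    using m fps_shift_in_formal[OF F] G unfolding bilinear_on_def by blast
  finally show ?thesis by (simp only: formal_decompose[OF L1])
qed

lemma bilinear_on_closed: "bilinear_on sA A sB B sC C m \<Longrightarrow> a \<in> A \<Longrightarrow> b \<in> B \<Longrightarrow> m a b \<in> C"
  unfolding bilinear_on_def by blast

lemma bilinear_on_flip:
  "bilinear_on sA A sB B sC C m \<Longrightarrow> bilinear_on sB B sA A sC C (\<lambda>b a. m a b)"
  unfolding bilinear_on_def by blast

text \<open>
  By linearity \<open>m(F, G) = m(F\<^sub>0, G) + \<lambda> m(F', G)\<close> with \<open>F'\<close> the shifted series. Hence the first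
  coefficient needs only the zeroth coefficient of \<open>m(F', G)\<close>, and by the same formula for \<open>F'\<close> that
  is the zeroth coefficient of \<open>m(F\<^sub>1, G)\<close>.
\<close>
lemma formal_bilinear_nth_1_left:
  assumes L: "vector_space (smul L1)" "vector_space (smul L3)" and A: "0 \<in> A"
    and m: "bilinear_on (formal_scale L1) (formal A) sB B (formal_scale L3) C m"
    and F: "F \<in> formal A" and G: "G \<in> B"
  shows "fps_nth (m F G) 1
    = fps_nth (m (fps_const (fps_nth F 0)) G) 1 + fps_nth (m (fps_const (fps_nth F 1)) G) 0"
proof -
  note expand = formal_bilinear_expand_left[OF L(1) A m _ G]
  have "fps_nth (m (fps_shift 1 F) G) 0 = fps_nth (m (fps_const (fps_nth F 1)) G) 0"
    by (subst expand[OF fps_shift_in_formal[OF F]])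
      (simp add: formal_scale_fps_X_nth[OF L(2)])
  then show ?thesis
    by (subst expand[OF F]) (simp add: formal_scale_fps_X_nth[OF L(2)])
qed

lemmas formal_bilinear_nth_1_right = formal_bilinear_nth_1_left[OF _ _ _ bilinear_on_flip]

text \<open>
  Each of the associativity laws of a bimodule has the form \<open>m P g = n f Q\<close>, where \<open>P\<close> and \<open>Q\<close> are
  themselves products. Applied to constants, \<open>P\<close> and \<open>Q\<close> are still series with all coefficients
  present, and the lemma reduces them to constants again.
\<close>
lemma first_order_identity:
  assumes L: "vector_space (smul L1)" "vector_space (smul L2)" "vector_space (smul L3)"
    and zero: "0 \<in> A" "0 \<in> B"
    and m: "bilinear_on (formal_scale L1) (formal A) sG G (formal_scale L3) E m"
    and n: "bilinear_on sF F (formal_scale L2) (formal B) (formal_scale L3) E' n"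
    and mem: "P \<in> formal A" "g \<in> G" "f \<in> F" "Q \<in> formal B"
    and eq: "m P g = n f Q"
  shows "fps_nth (m (fps_const (fps_nth P 0)) g) 1 + fps_nth (m (fps_const (fps_nth P 1)) g) 0
       = fps_nth (n f (fps_const (fps_nth Q 0))) 1 + fps_nth (n f (fps_const (fps_nth Q 1))) 0"
  using formal_bilinear_nth_1_left[OF L(1,3) zero(1) m mem(1,2)]
    formal_bilinear_nth_1_right[OF L(2,3) zero(2) n mem(4,3)] eq
  by simp

section \<open>The contravariant connection of a bimodule quantization\<close>

theorem proposition4p3:
  fixes M :: "'m::{t2_space, second_countable_topology} smooth_space"
    and \<pi> :: "'m bivector"
    and L :: "('m, 'v::ab_group_add) vbundle"
    and star star' :: "('m \<Rightarrow> complex) fps \<Rightarrow> ('m \<Rightarrow> complex) fps \<Rightarrow> ('m \<Rightarrow> complex) fps"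
    and C C' :: "nat \<Rightarrow> ('m \<Rightarrow> complex) \<Rightarrow> ('m \<Rightarrow> complex) \<Rightarrow> 'm \<Rightarrow> complex"
    and bul :: "('m \<Rightarrow> 'v) fps \<Rightarrow> ('m \<Rightarrow> complex) fps \<Rightarrow> ('m \<Rightarrow> 'v) fps"
    and bul' :: "('m \<Rightarrow> complex) fps \<Rightarrow> ('m \<Rightarrow> 'v) fps \<Rightarrow> ('m \<Rightarrow> 'v) fps"
    and R :: "nat \<Rightarrow> ('m \<Rightarrow> 'v) \<Rightarrow> ('m \<Rightarrow> complex) \<Rightarrow> 'm \<Rightarrow> 'v"
    and R' :: "nat \<Rightarrow> ('m \<Rightarrow> complex) \<Rightarrow> ('m \<Rightarrow> 'v) \<Rightarrow> 'm \<Rightarrow> 'v"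
  assumes "smooth_manifold M"
    and "poisson_structure M \<pi>"
    and "complex_line_bundle M L"
    and "star_product M \<pi> star C"
    and "star_product M \<pi> star' C'"
    and "\<forall>f\<in>C_inf M. \<forall>g\<in>C_inf M. C 1 f g = C' 1 f g"
    and "bimodule_quantization M L star star' bul R bul' R'"
  shows "contravariant_connection M \<pi> L (\<lambda>s f. R 1 s f - R' 1 f s)"
proof -
  note M = \<open>smooth_manifold M\<close> and L = \<open>complex_line_bundle M L\<close>
    and C_eq = \<open>\<forall>f\<in>C_inf M. \<forall>g\<in>C_inf M. C 1 f g = C' 1 f g\<close>
  let ?T = "trivial_bundle :: ('m, complex) vbundle"
  \<comment> \<open>The first order operators are written with index \<open>1\<close>, which has to stay in this form.\<close>
  note One_nat_def [simp del]
  let ?D = "\<lambda>s f. R 1 s f - R' 1 f s"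
  have vsL: "vector_space (smul L)" using L by (simp add: complex_line_bundle_def)
  interpret vector_space "smul L" by (rule vsL)
  note vsT = vector_space_trivial_bundle

  have star_bil: "bilinear_on (formal_scale ?T) (formal_C_inf M) (formal_scale ?T) (formal_C_inf M)
      (formal_scale ?T) (formal_C_inf M) star"
    and star_const: "\<forall>f\<in>C_inf M. \<forall>g\<in>C_inf M.
      star (fps_const f) (fps_const g) = Abs_fps (\<lambda>r. C r f g) \<and> C 0 f g = f * g"
    and bracket: "\<forall>f\<in>C_inf M. \<forall>g\<in>C_inf M. C 1 f g - C 1 g f = bracket M \<pi> f g"
    using \<open>star_product M \<pi> star C\<close> by (simp_all add: star_product_def)
  have star'_bil: "bilinear_on (formal_scale ?T) (formal_C_inf M) (formal_scale ?T) (formal_C_inf M)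
      (formal_scale ?T) (formal_C_inf M) star'"
    and star'_const: "\<forall>f\<in>C_inf M. \<forall>g\<in>C_inf M.
      star' (fps_const f) (fps_const g) = Abs_fps (\<lambda>r. C' r f g) \<and> C' 0 f g = f * g"
    using \<open>star_product M \<pi> star' C'\<close> by (simp_all add: star_product_def)
  note q = \<open>bimodule_quantization M L star star' bul R bul' R'\<close>[unfolded bimodule_quantization_def]
  have bil: "bilinear_on (formal_scale L) (formal_sections M L) (formal_scale ?T) (formal_C_inf M)
      (formal_scale L) (formal_sections M L) bul"
    and bil': "bilinear_on (formal_scale ?T) (formal_C_inf M) (formal_scale L) (formal_sections M L)
      (formal_scale L) (formal_sections M L) bul'"
    and bul_const: "\<forall>s\<in>sections M L. \<forall>f\<in>C_inf M. bul (fps_const s) (fps_const f)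
      = Abs_fps (\<lambda>r. if r = 0 then fun_smul L f s else R r s f)"
    and bul'_const: "\<forall>s\<in>sections M L. \<forall>f\<in>C_inf M. bul' (fps_const f) (fps_const s)
      = Abs_fps (\<lambda>r. if r = 0 then fun_smul L f s else R' r f s)"
    using q by - (elim conjE, assumption)+
  have right_action: "\<forall>S\<in>formal_sections M L. \<forall>F\<in>formal_C_inf M. \<forall>G\<in>formal_C_inf M.
      bul (bul S F) G = bul S (star F G)"
    and left_action: "\<forall>S\<in>formal_sections M L. \<forall>F\<in>formal_C_inf M. \<forall>G\<in>formal_C_inf M.
      bul' F (bul' G S) = bul' (star' F G) S"
    and bimodule: "\<forall>S\<in>formal_sections M L. \<forall>F\<in>formal_C_inf M. \<forall>G\<in>formal_C_inf M.
      bul (bul' F S) G = bul' F (bul S G)"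
    using q by - (elim conjE, assumption)+
  have assoc: "bul (bul S F) G = bul S (star F G)" "bul' (star' F G) S = bul' F (bul' G S)"
    "bul (bul' F S) G = bul' F (bul S G)"
    if "S \<in> formal_sections M L" "F \<in> formal_C_inf M" "G \<in> formal_C_inf M" for S F G
    by (rule right_action[rule_format, OF that] left_action[rule_format, OF that, symmetric]
        bimodule[rule_format, OF that])+
  have "\<forall>r\<ge>1. bidifferential M L ?T L (R r)" "\<forall>r\<ge>1. bidifferential M ?T L L (R' r)"
    using q by - (elim conjE, assumption)+
  then have R: "bilinear_on (cscale L) (sections M L) (cscale ?T) (C_inf M)
      (cscale L) (sections M L) (R 1)"
    and R': "bilinear_on (cscale ?T) (C_inf M) (cscale L) (sections M L)
      (cscale L) (sections M L) (R' 1)"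
    by (simp_all add: bidifferential_def sections_trivial_bundle)

  have first_order:
    "R 1 (fun_smul L f s) g + fun_smul L g (R 1 s f) = R 1 s (f * g) + fun_smul L (C 1 f g) s"
    "R' 1 (f * g) s + fun_smul L (C 1 f g) s = R' 1 f (fun_smul L g s) + fun_smul L f (R' 1 g s)"
    "R 1 (fun_smul L f s) g + fun_smul L g (R' 1 f s)
      = R' 1 f (fun_smul L g s) + fun_smul L f (R 1 s g)"
    if s: "s \<in> sections M L" and f: "f \<in> C_inf M" and g: "g \<in> C_inf M" for s f g
  proof -
    \<comment> \<open>A constant series has zero as its higher coefficients, so it is a formal section or a formal
      function only because zero is one.\<close>
    have z: "0 \<in> sections M L" "0 \<in> C_inf M"
      using sections_diff[OF M L s s] C_inf_diff[OF M f f] by simp_all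
    note const [simp] = fps_const_in_formal[OF z(1)] fps_const_in_formal[OF z(2)]
    have star_in: "star F G \<in> formal_C_inf M" "star' F G \<in> formal_C_inf M"
      if "F \<in> formal_C_inf M" "G \<in> formal_C_inf M" for F G
      using that by (simp_all add: bilinear_on_closed[OF star_bil] bilinear_on_closed[OF star'_bil])
    have bul_in: "bul S F \<in> formal_sections M L" "bul' F S \<in> formal_sections M L"
      if "S \<in> formal_sections M L" "F \<in> formal_C_inf M" for S F
      using that by (simp_all add: bilinear_on_closed[OF bil] bilinear_on_closed[OF bil'])
    have bul_nth: "fps_nth (bul (fps_const s) (fps_const f)) 0 = fun_smul L f s"
      "fps_nth (bul (fps_const s) (fps_const f)) 1 = R 1 s f"
      "fps_nth (bul' (fps_const f) (fps_const s)) 0 = fun_smul L f s"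
      "fps_nth (bul' (fps_const f) (fps_const s)) 1 = R' 1 f s"
      if "s \<in> sections M L" "f \<in> C_inf M" for s f
      using bul_const bul'_const that by simp_all
    have star_nth: "fps_nth (star (fps_const f) (fps_const g)) 0 = f * g"
      "fps_nth (star (fps_const f) (fps_const g)) 1 = C 1 f g"
      "fps_nth (star' (fps_const f) (fps_const g)) 0 = f * g"
      "fps_nth (star' (fps_const f) (fps_const g)) 1 = C 1 f g"
      using star_const star'_const f g C_eq by simp_all
    \<comment> \<open>Products of smooth objects are smooth because they are the zeroth coefficients of the formal
      products, which stay in the formal modules.\<close>
    have smul_in [simp]: "fun_smul L f s \<in> sections M L"
      if "s \<in> sections M L" "f \<in> C_inf M" for s f
    proof -
      have "fps_nth (bul (fps_const s) (fps_const f)) 0 \<in> sections M L"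
        using bul_in(1)[OF const(1)[OF that(1)] const(2)[OF that(2)]] by (simp add: formal_def)
      then show ?thesis by (simp only: bul_nth(1)[OF that])
    qed
    have R_in [simp]: "R 1 s f \<in> sections M L" "R' 1 f s \<in> sections M L"
      if "s \<in> sections M L" "f \<in> C_inf M" for s f
      using that by (simp_all add: bilinear_on_closed[OF R] bilinear_on_closed[OF R'])
    have C_in [simp]: "f * g \<in> C_inf M" "C 1 f g \<in> C_inf M"
    proof -
      have "fps_nth (star (fps_const f) (fps_const g)) k \<in> C_inf M" for k
        using star_in(1)[OF const(2)[OF f] const(2)[OF g]] by (simp add: formal_def)
      from this[of 0] this[of 1] show "f * g \<in> C_inf M" "C 1 f g \<in> C_inf M"
        by (simp_all only: star_nth)
    qed
    note assoc' = assoc[OF const(1)[OF s] const(2)[OF f] const(2)[OF g]]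
    note fo = first_order_identity[OF _ _ vsL]
    show "R 1 (fun_smul L f s) g + fun_smul L g (R 1 s f) = R 1 s (f * g) + fun_smul L (C 1 f g) s"
      using fo[OF vsL vsT z bil bil _ _ _ _ assoc'(1)] s f g
      by (simp add: bul_in star_in bul_nth star_nth)
    show "R' 1 (f * g) s + fun_smul L (C 1 f g) s
        = R' 1 f (fun_smul L g s) + fun_smul L f (R' 1 g s)"
      using fo[OF vsT vsL z(2,1) bil' bil' _ _ _ _ assoc'(2)] s f g
      by (simp add: bul_in star_in bul_nth star_nth)
    show "R 1 (fun_smul L f s) g + fun_smul L g (R' 1 f s)
        = R' 1 f (fun_smul L g s) + fun_smul L f (R 1 s g)"
      using fo[OF vsL vsL z(1,1) bil bil' _ _ _ _ assoc'(3)] s f g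
      by (simp add: bul_in star_in bul_nth star_nth)
  qed

  have smul_diff: "fun_smul L f (s - s') = fun_smul L f s - fun_smul L f s'" for f s s'
    by (simp add: fun_smul_def fun_eq_iff scale_right_diff_distrib)

  show ?thesis
    unfolding contravariant_connection_def
  proof (intro conjI ballI)
    show "bilinear_on (cscale L) (sections M L) (cscale trivial_bundle) (C_inf M)
        (cscale L) (sections M L) ?D"
    proof -
      have "cscale L k (s - s') = cscale L k s - cscale L k s'" for k s s'
        by (simp add: cscale_def fun_eq_iff scale_right_diff_distrib)
      then show ?thesis
        using R R' by (simp add: bilinear_on_def sections_diff[OF M L] algebra_simps)
    qed
  next
    fix s f g assume "s \<in> sections M L" "f \<in> C_inf M" "g \<in> C_inf M"
    note fo = first_order[OF this]
    have "R 1 s (f * g) = R 1 (fun_smul L f s) g + fun_smul L g (R 1 s f) - fun_smul L (C 1 f g) s"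
      using fo(1) by (simp add: eq_diff_eq)
    moreover have "R' 1 (f * g) s
        = R' 1 f (fun_smul L g s) + fun_smul L f (R' 1 g s) - fun_smul L (C 1 f g) s"
      using fo(2) by (simp add: eq_diff_eq)
    moreover have "R 1 (fun_smul L f s) g
        = R' 1 f (fun_smul L g s) + fun_smul L f (R 1 s g) - fun_smul L g (R' 1 f s)"
      using fo(3) by (simp add: eq_diff_eq)
    ultimately show "?D s (f * g) = fun_smul L g (?D s f) + fun_smul L f (?D s g)"
      by (simp add: smul_diff)
  next
    fix s f g assume s: "s \<in> sections M L" and f: "f \<in> C_inf M" and g: "g \<in> C_inf M"
    have "R 1 (fun_smul L f s) g
        = R' 1 f (fun_smul L g s) + fun_smul L f (R 1 s g) - fun_smul L g (R' 1 f s)"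
      using first_order(3)[OF s f g] by (simp add: eq_diff_eq)
    moreover have "R' 1 f (fun_smul L g s)
        = R' 1 (f * g) s + fun_smul L (C 1 f g) s - fun_smul L f (R' 1 g s)"
      using first_order(2)[OF s f g] by (simp add: eq_diff_eq)
    moreover have "R' 1 g (fun_smul L f s)
        = R' 1 (f * g) s + fun_smul L (C 1 g f) s - fun_smul L g (R' 1 f s)"
      using first_order(2)[OF s g f] by (simp add: eq_diff_eq mult.commute[of g f])
    moreover have "fun_smul L (C 1 f g) s - fun_smul L (C 1 g f) s = fun_smul L (bracket M \<pi> f g) s"
    proof -
      have "bracket M \<pi> f g = C 1 f g - C 1 g f" using bracket f g by simp
      then show ?thesis by (simp add: fun_smul_def fun_eq_iff scale_left_diff_distrib)
    qed
    ultimately show "?D (fun_smul L f s) g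
        = fun_smul L f (?D s g) + fun_smul L (bracket M \<pi> f g) s"
      by (simp add: smul_diff)
  qed
qed

end
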